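(* Let $\mathcal{H}$ be a real Hilbert space and assume that $T:\mathcal{H}\to\mathcal{H}$ is a nonexpansive mapping such that $\mathrm{Fix}(T)\neq\emptyset$. Let the initial guess $x^0\in\mathcal{H}$ be chosen arbitrarily, let the anchor be $u=2x^0-Tx^0$, and let $\{x^k\}_{k=0}^\infty$ be the sequence generated by $$x^k=\frac{1}{k+3}u+\frac{k+2}{k+3}Tx^{k-1},\qquad k\ge 1.$$ Then $$\|x^k-Tx^k\|\le \frac{2}{k+3}\|u-x^*\|,\qquad k\ge 1,$$ where $x^*$ is an arbitrary fixed point of $T$. This convergence rate estimate is tight.
   Context: A mapping $T:\mathcal{H}\to\mathcal{H}$ is nonexpansive if $\|Tx-Ty\|\le\|x-y\|$ for all $x,y\in\mathcal{H}$. $\mathrm{Fix}(T)=\{x\in\mathcal{H}: Tx=x\}$ is the set of fixed points of $T$. *)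

theory Defs imports "HOL-Analysis.Analysis"
begin

definition nonexpansive :: "('a::real_normed_vector \<Rightarrow> 'a) \<Rightarrow> bool" where
  "nonexpansive T \<longleftrightarrow> (\<forall>x y. norm (T x - T y) \<le> norm (x - y))"

definition Fix :: "('a \<Rightarrow> 'a) \<Rightarrow> 'a set" where
  "Fix T = {x. T x = x}"

definition anchor :: "('a::real_vector \<Rightarrow> 'a) \<Rightarrow> 'a \<Rightarrow> 'a" where
  "anchor T x0 = 2 *\<^sub>R x0 - T x0"

(* x 0 is unconstrained: it is the arbitrary initial guess. *)
definition halpern_seq :: "('a::real_vector \<Rightarrow> 'a) \<Rightarrow> 'a \<Rightarrow> (nat \<Rightarrow> 'a) \<Rightarrow> bool" where
  "halpern_seq T u x \<longleftrightarrow>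
     (\<forall>k\<ge>1. x k = (1 / (real k + 3)) *\<^sub>R u + ((real k + 2) / (real k + 3)) *\<^sub>R T (x (k - 1)))"

end

theory Submission imports Defs
begin

text \<open>
  With residuals \<open>r k = x k - T (x k)\<close>, the quantity
  \<open>(k + 2) / 2 * (r k \<bullet> r k) + r k \<bullet> (x k - u)\<close> vanishes at \<open>k = 0\<close> because \<open>x 0 - u = - r 0\<close>, and
  nonexpansiveness at two consecutive iterates shows that it stays nonpositive. Adding
  \<open>r k \<bullet> r k \<le> 2 * (r k \<bullet> (x k - x\<^sup>*))\<close>, which is nonexpansiveness at \<open>x k\<close> and the fixed point, gives
  \<open>(k + 3) / 2 * (r k \<bullet> r k) \<le> r k \<bullet> (u - x\<^sup>*)\<close>, and Cauchy-Schwarz finishes.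

  For tightness at index \<open>k\<close>, the iterates of \<open>t \<mapsto> \<bar>t - 1\<bar> - 1\<close> on a line, with \<open>x 0 = k + 1\<close> and
  \<open>u = k + 3\<close>, descend by unit steps to \<open>x k = 1\<close>; up to that index the map is translation by \<open>-2\<close>,
  so all residuals are \<open>2\<close>.
\<close>

lemma nonexpansive_inner_le:
  fixes T :: "'a::real_inner \<Rightarrow> 'a"
  assumes "nonexpansive T"
  shows "(T x - T y) \<bullet> (T x - T y) \<le> (x - y) \<bullet> (x - y)"
  using assms by (simp add: nonexpansive_def flip: norm_le)

text \<open>Here \<open>T x - p\<close> is \<open>x - p\<close> minus the residual; expanding its
  square against that of \<open>x - p\<close> cancels the latter.\<close>

lemma residual_fixed_point_le:
  fixes T :: "'a::real_inner \<Rightarrow> 'a"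
  assumes "nonexpansive T" and "p \<in> Fix T"
  shows "(x - T x) \<bullet> (x - T x) \<le> 2 * ((x - T x) \<bullet> (x - p))"
proof -
  have "T x - T p = (x - p) - (x - T x)"
    using assms(2) by (simp add: Fix_def)
  then show ?thesis
    using nonexpansive_inner_le[OF assms(1), of x p]
    by (simp add: inner_diff_left inner_diff_right inner_commute)
qed

definition halpern_potential :: "('a::real_inner \<Rightarrow> 'a) \<Rightarrow> 'a \<Rightarrow> real \<Rightarrow> 'a \<Rightarrow> real" where
  "halpern_potential T u m y = m / 2 * ((y - T y) \<bullet> (y - T y)) + (y - T y) \<bullet> (y - u)"

text \<open>In terms of \<open>w\<close>, the potentials at \<open>y\<close> and \<open>z\<close>
  become \<open>(m + 1) / 2 * (r \<bullet> r + 2 * (r \<bullet> w))\<close> and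
  \<open>m / 2 * (s \<bullet> s + 2 * (s \<bullet> w))\<close>. Nonexpansiveness says that
  \<open>w + s\<close> is no longer than \<open>w + r\<close>; cancelling
  \<open>w \<bullet> w\<close> compares the two brackets.\<close>

lemma halpern_potential_step:
  fixes T :: "'a::real_inner \<Rightarrow> 'a"
  assumes T: "nonexpansive T" and m: "m > 0"
    and z: "z = (1 / (m + 1)) *\<^sub>R u + (m / (m + 1)) *\<^sub>R T y"
    and pot: "halpern_potential T u (m - 1) y \<le> 0"
  shows "halpern_potential T u m z \<le> 0"
proof -
  define r s w where "r = y - T y" and "s = z - T z" and "w = (1 / (m + 1)) *\<^sub>R (T y - u)"
  have Ty: "T y - u = (m + 1) *\<^sub>R w"
    using m by (simp add: w_def)
  have "u = (1 / (m + 1)) *\<^sub>R u + (m / (m + 1)) *\<^sub>R u"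
    using m by (simp add: field_simps flip: scaleR_left_distrib)
  then have zu: "z - u = m *\<^sub>R w"
    unfolding z w_def by (simp add: algebra_simps)
  have yu: "y - u = (m + 1) *\<^sub>R w + r"
    using Ty by (simp add: r_def algebra_simps)
  have "T y - T z = (T y - u) - (z - u) + s"
    by (simp add: s_def)
  then have TT: "T y - T z = w + s"
    unfolding Ty zu by (simp add: algebra_simps)
  have "y - z = (y - u) - (z - u)"
    by simp
  then have yz: "y - z = w + r"
    unfolding yu zu by (simp add: algebra_simps)
  have le: "s \<bullet> s + 2 * (s \<bullet> w) \<le> r \<bullet> r + 2 * (r \<bullet> w)"
    using nonexpansive_inner_le[OF T, of y z] unfolding TT yz
    by (simp add: inner_add_left inner_add_right inner_commute)
  have "halpern_potential T u (m - 1) y = (m + 1) / 2 * (r \<bullet> r + 2 * (r \<bullet> w))"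
    unfolding halpern_potential_def yu r_def[symmetric]
    by (simp add: inner_add_right field_simps)
  then have "r \<bullet> r + 2 * (r \<bullet> w) \<le> 0"
    using pot m by (simp only: mult_le_0_iff) auto
  with le have "m / 2 * (s \<bullet> s + 2 * (s \<bullet> w)) \<le> 0"
    using m by (simp add: mult_le_0_iff)
  then show ?thesis
    unfolding halpern_potential_def zu s_def[symmetric]
    by (simp add: field_simps)
qed

lemma halpern_potential_nonpos:
  fixes T :: "'a::real_inner \<Rightarrow> 'a"
  assumes T: "nonexpansive T" and u: "u = anchor T (x 0)" and x: "halpern_seq T u x"
  shows "halpern_potential T u (real k + 2) (x k) \<le> 0"
proof (induction k)
  case 0
  have "x 0 - u = - (x 0 - T (x 0))"
    by (simp add: u anchor_def algebra_simps scaleR_2)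
  then show ?case
    by (simp add: halpern_potential_def del: minus_diff_eq)
next
  case (Suc k)
  \<comment> \<open>The anchor weight \<open>1 / (k + 4)\<close> of this iterate is
    \<open>1 / (m + 1)\<close> for \<open>m = k + 3\<close>.\<close>
  have "x (Suc k) = (1 / ((real k + 3) + 1)) *\<^sub>R u + ((real k + 3) / ((real k + 3) + 1)) *\<^sub>R T (x k)"
    using x[unfolded halpern_seq_def, rule_format, of "Suc k"] by (simp add: add.commute)
  then have "halpern_potential T u (real k + 3) (x (Suc k)) \<le> 0"
    using Suc.IH by (intro halpern_potential_step[OF T, of "real k + 3" _ _ "x k"]) (simp_all add: add.commute)
  then show ?case
    by (simp add: add.commute)
qed

lemma halpern_residual_le:
  fixes T :: "'a::real_inner \<Rightarrow> 'a"
  assumes T: "nonexpansive T" and u: "u = anchor T (x 0)" and x: "halpern_seq T u x"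
    and p: "p \<in> Fix T"
  shows "norm (x k - T (x k)) \<le> 2 / (real k + 3) * norm (u - p)"
proof -
  define r where "r = x k - T (x k)"
  \<comment> \<open>Half of the fixed-point estimate raises the coefficient from
    \<open>(k + 2) / 2\<close> to \<open>(k + 3) / 2\<close>, and the terms in \<open>x k\<close>
    cancel.\<close>
  have "(real k + 3) / 2 * (r \<bullet> r) \<le> r \<bullet> (u - p)"
    using halpern_potential_nonpos[OF T u x, of k] residual_fixed_point_le[OF T p, of "x k"]
    by (simp add: halpern_potential_def field_simps inner_diff_right flip: r_def)
  also have "\<dots> \<le> norm r * norm (u - p)"
    by (rule norm_cauchy_schwarz)
  finally have "norm r * ((real k + 3) / 2 * norm r) \<le> norm r * norm (u - p)"
    by (simp add: dot_square_norm power2_eq_square algebra_simps)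
  then have "(real k + 3) / 2 * norm r \<le> norm (u - p)"
    by (cases "r = 0") auto
  then show ?thesis
    by (simp add: r_def field_simps)
qed

text \<open>For a unit vector \<open>e\<close> this is the orthogonal projection onto the line of
  \<open>e\<close> followed by the one-dimensional example, which places that example in any nonzero
  space.\<close>

definition fold_map :: "'a::real_inner \<Rightarrow> 'a \<Rightarrow> 'a" where
  "fold_map e z = (\<bar>z \<bullet> e - 1\<bar> - 1) *\<^sub>R e"

lemma nonexpansive_fold_map:
  assumes e: "norm e = 1"
  shows "nonexpansive (fold_map e)"
  unfolding nonexpansive_def
proof (intro allI)
  fix z w
  have "norm (fold_map e z - fold_map e w) = \<bar>\<bar>z \<bullet> e - 1\<bar> - \<bar>w \<bullet> e - 1\<bar>\<bar>"
    by (simp add: fold_map_def e flip: scaleR_left_diff_distrib)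
  also have "\<dots> \<le> \<bar>(z - w) \<bullet> e\<bar>"
    by (simp add: inner_diff_left)
  also have "\<dots> \<le> norm (z - w)"
    using Cauchy_Schwarz_ineq2[of "z - w" e] by (simp add: e)
  finally show "norm (fold_map e z - fold_map e w) \<le> norm (z - w)" .
qed

lemma fold_map_scaleR:
  assumes "norm e = 1" and "t \<ge> 1"
  shows "fold_map e (t *\<^sub>R e) = (t - 2) *\<^sub>R e"
  using assms by (simp add: fold_map_def dot_square_norm)

lemma halpern_seq_exists: "\<exists>x. x 0 = x0 \<and> halpern_seq T u x"
proof (intro exI conjI)
  \<comment> \<open>The recursor supplies \<open>j\<close> for the step from \<open>j\<close> to
    \<open>Suc j\<close>, whose weights use the index \<open>Suc j\<close>.\<close>
  let ?x = "rec_nat x0 (\<lambda>j y. (1 / (real (Suc j) + 3)) *\<^sub>R u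
    + ((real (Suc j) + 2) / (real (Suc j) + 3)) *\<^sub>R T y)"
  show "?x 0 = x0"
    by simp
  show "halpern_seq T u ?x"
    unfolding halpern_seq_def by (auto simp: Suc_le_eq gr0_conv_Suc)
qed

lemma halpern_seq_fold_map:
  fixes e :: "'a::real_inner"
  assumes e: "norm e = 1" and x0: "x 0 = (real k + 1) *\<^sub>R e"
    and x: "halpern_seq (fold_map e) ((real k + 3) *\<^sub>R e) x"
    and "j \<le> k"
  shows "x j = (real k + 1 - real j) *\<^sub>R e"
  using \<open>j \<le> k\<close>
proof (induction j)
  case 0
  show ?case
    using x0 by simp
next
  case (Suc j)
  \<comment> \<open>As \<open>Suc j \<le> k\<close>, the coordinate \<open>k + 1 - j\<close> is at
    least 2, within the range where the map translates by -2.\<close>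
  have "fold_map e (x j) = (real k - 1 - real j) *\<^sub>R e"
    using Suc fold_map_scaleR[OF e, of "real k + 1 - real j"] by (simp add: diff_diff_eq add.commute)
  then have "x (Suc j) = (1 / (real j + 4) * (real k + 3)
      + (real j + 3) / (real j + 4) * (real k - 1 - real j)) *\<^sub>R e"
    using x[unfolded halpern_seq_def, rule_format, of "Suc j"]
    by (simp add: add.commute flip: scaleR_left_distrib)
  also have "1 / (real j + 4) * (real k + 3) + (real j + 3) / (real j + 4) * (real k - 1 - real j)
      = real k + 1 - real (Suc j)"
    by (simp add: divide_simps) (simp add: algebra_simps)
  finally show ?case .
qed

text \<open>With fixed point 0 the distance to the anchor is \<open>k + 3\<close>, so the bound
  equals the residual norm 2. The map and starting point depend on \<open>k\<close>;
  \<open>u \<noteq> p\<close> rules out the degenerate equality of zeros.\<close>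

lemma halpern_residual_tight:
  assumes "\<exists>v::'a::real_inner. v \<noteq> 0"
  shows "\<exists>(T :: 'a \<Rightarrow> 'a) x0 u x.
    nonexpansive T \<and> u = anchor T x0 \<and> x 0 = x0 \<and> halpern_seq T u x \<and>
    (\<exists>p \<in> Fix T. u \<noteq> p \<and> norm (x k - T (x k)) = 2 / (real k + 3) * norm (u - p))"
proof -
  obtain v :: 'a where "v \<noteq> 0"
    using assms by blast
  then obtain e :: 'a where e: "norm e = 1"
    using norm_sgn[of v] by auto
  \<comment> \<open>The map sends coordinate \<open>k + 1\<close> to \<open>k - 1\<close>, so the
    anchor has coordinate \<open>2 * (k + 1) - (k - 1) = k + 3\<close>.\<close>
  define u where "u = (real k + 3) *\<^sub>R e"
  obtain x where x0: "x 0 = (real k + 1) *\<^sub>R e" and x: "halpern_seq (fold_map e) u x"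
    using halpern_seq_exists by blast
  have anchor: "u = anchor (fold_map e) (x 0)"
    by (simp add: anchor_def u_def x0 fold_map_scaleR[OF e] flip: scaleR_left_diff_distrib)
  have "x k = 1 *\<^sub>R e"
    using halpern_seq_fold_map[OF e x0 x[unfolded u_def], of k] by simp
  then have "x k - fold_map e (x k) = 2 *\<^sub>R e"
    using fold_map_scaleR[OF e, of 1] by (simp add: scaleR_2)
  moreover have "norm u = real k + 3"
    by (simp add: u_def e)
  ultimately have "norm (x k - fold_map e (x k)) = 2 / (real k + 3) * norm (u - 0)"
    by (simp add: e divide_simps)
  moreover have "0 \<in> Fix (fold_map e)"
    by (simp add: Fix_def fold_map_def)
  moreover have "u \<noteq> 0"
    using e by (auto simp: u_def)
  ultimately have "\<exists>p \<in> Fix (fold_map e). u \<noteq> p \<and>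
      norm (x k - fold_map e (x k)) = 2 / (real k + 3) * norm (u - p)"
    by (intro bexI[of _ 0] conjI)
  then show ?thesis
    using nonexpansive_fold_map[OF e] anchor x
    by (intro exI[of _ "fold_map e"] exI[of _ "x 0"] exI[of _ u] exI[of _ x] conjI refl)
qed

theorem theorem3p2:
  shows
    "(\<forall>(T :: 'a::{real_inner, complete_space} \<Rightarrow> 'a) x0 u x.
        nonexpansive T \<longrightarrow> Fix T \<noteq> {} \<longrightarrow>
        u = anchor T x0 \<longrightarrow> x 0 = x0 \<longrightarrow> halpern_seq T u x \<longrightarrow>
        (\<forall>xstar \<in> Fix T. \<forall>k\<ge>1.
           norm (x k - T (x k)) \<le> 2 / (real k + 3) * norm (u - xstar)))
     \<and>
     ((\<exists>v::'a. v \<noteq> 0) \<longrightarrow>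
       (\<forall>k\<ge>1. \<exists>(T :: 'a \<Rightarrow> 'a) x0 u x.
          nonexpansive T \<and>
          u = anchor T x0 \<and> x 0 = x0 \<and> halpern_seq T u x \<and>
          (\<exists>xstar \<in> Fix T. u \<noteq> xstar \<and>
             norm (x k - T (x k)) = 2 / (real k + 3) * norm (u - xstar))))"
proof (intro conjI allI impI ballI)
  fix T :: "'a \<Rightarrow> 'a" and x0 u x xstar and k :: nat
  assume "nonexpansive T" "u = anchor T x0" "x 0 = x0" "halpern_seq T u x" "xstar \<in> Fix T"
  then show "norm (x k - T (x k)) \<le> 2 / (real k + 3) * norm (u - xstar)"
    using halpern_residual_le[of T u x xstar k] by simp
qed (rule halpern_residual_tight)

end
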